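(* Let $K$ be a field, let $n\ge 1$ and $j$ be integers with $0\le j\le n$, and let $R=R(K[X_1,\ldots,X_n])$. Then there is a unique prime ideal $P$ of $R$ such that $R_P$ is the reciprocal complement of $L[X_1,\ldots,X_j]$, i.e. $R_P=R(L[X_1,\ldots,X_j])$ as subrings of $K(X_1,\ldots,X_n)$, where $L=K(X_{j+1},\ldots,X_n)$.
   Context: For an integral domain $T$, the reciprocal complement $R(T)$ is the subring of the fraction field of $T$ generated by all $1/f$ with $f\in T\setminus\{0\}$. Here $X_1,\ldots,X_n$ are indeterminates over $K$. *)

theory Defs
  imports
    "HOL-Library.Poly_Mapping"
    "HOL-Computational_Algebra.Fraction_Field"
    "HOL-Algebra.Ideal"
    "HOL-Algebra.Generated_Fields"
    "HOL-Algebra.Algebraic_Closure_Type"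
begin

section \<open>Subrings of a field\<close>

text \<open>
  Rings occurring here are subsets of a field given by a type of class
  \<^class>\<open>Fields.field\<close>; \<^const>\<open>ring_of_type_algebra\<close> is that field as a ring
  record, and \<open>ring_on A\<close> is \<open>A\<close> with the inherited operations.
\<close>

definition ring_on :: "'a::field set \<Rightarrow> 'a ring" where
  "ring_on A = ring_of_type_algebra\<lparr>carrier := A\<rparr>"

definition adjoin :: "'a::field set \<Rightarrow> 'a set \<Rightarrow> 'a set" where
  "adjoin A S = generate_ring ring_of_type_algebra (A \<union> S)"

definition adjoin_field :: "'a::field set \<Rightarrow> 'a set \<Rightarrow> 'a set" where
  "adjoin_field A S = generate_field ring_of_type_algebra (A \<union> S)"

text \<open>
  For a domain \<open>T\<close> inside a field \<open>F\<close>, the elements \<open>1 / f\<close> lie in the copy of the fraction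
  field of \<open>T\<close> in \<open>F\<close>, so generating a subring of \<open>F\<close> or of that fraction field gives
  the same set.
\<close>

definition reciprocal_complement :: "'a::field set \<Rightarrow> 'a set" where
  "reciprocal_complement T = generate_ring ring_of_type_algebra {1 / f |f. f \<in> T - {0}}"

text \<open>The localization of a subring \<open>R\<close> of a field at a prime ideal \<open>P\<close>, taken inside the field.\<close>

definition localization_at :: "'a::field set \<Rightarrow> 'a set \<Rightarrow> 'a set" where
  "localization_at R P = {a / s |a s. a \<in> R \<and> s \<in> R - P}"


section \<open>Rational functions\<close>

text \<open>
  Rational functions over \<open>'k\<close> in countably many indeterminates \<open>indet 0, indet 1, \<dots>\<close>. A polynomial
  maps exponent vectors to coefficients. The field of rational functions in \<open>indet 1, \<dots>, indet n\<close> is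
  the subfield \<open>adjoin_field (range scalar) (indet ` {1..n})\<close>; working in one ambient type allows
  \<open>n\<close> to be an ordinary variable.
\<close>

type_synonym 'k ratfun = "((nat \<Rightarrow>\<^sub>0 nat) \<Rightarrow>\<^sub>0 'k) fract"

definition scalar :: "'k::field \<Rightarrow> 'k ratfun" where
  "scalar c = Fract (Poly_Mapping.single 0 c) 1"

definition indet :: "nat \<Rightarrow> 'k::field ratfun" where
  "indet i = Fract (Poly_Mapping.single (Poly_Mapping.single i 1) 1) 1"

end

theory Submission
  imports Defs
begin

text \<open>
  Write \<open>T = K[X\<^sub>1, \<dots>, X\<^sub>n]\<close>, \<open>W = K[X\<^bsub>j+1\<^esub>, \<dots>, X\<^sub>n]\<close> and \<open>T' = L[X\<^sub>1, \<dots>, X\<^sub>j]\<close>,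
  so that \<open>T'\<close> consists of the fractions \<open>t / w\<close> with \<open>t \<in> T\<close> and \<open>0 \<noteq> w \<in> W\<close>.
  The reciprocals of the nonzero elements of \<open>T'\<close> are the products \<open>w \<cdot> (1 / t)\<close>, and inverting
  \<open>1 / w \<in> R(T)\<close> amounts to adjoining \<open>w\<close>. Hence \<open>R(T')\<close> is the localization of \<open>R(T)\<close> at the
  multiplicative set of all \<open>1 / w\<close> (\<open>reciprocal_complement_fractions\<close>).

  It remains to see that \<open>R(T')\<close> is a local ring, since a ring of fractions of \<open>R(T)\<close> that is
  local is also the localization at the contraction of its maximal ideal. As products of
  reciprocals are reciprocals, every element of \<open>R(T')\<close> is a sum \<open>c + 1 / f\<^sub>1 + \<dots> + 1 / f\<^sub>m\<close> with
  \<open>c \<in> L\<close> and nonconstant \<open>f\<^sub>i \<in> T'\<close>. The sum of the \<open>1 / f\<^sub>i\<close> has negative total degree in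
  \<open>X\<^sub>1, \<dots>, X\<^sub>j\<close>, so the elements with \<open>c = 0\<close> form a proper ideal. The main point is that an element
  with \<open>c \<noteq> 0\<close> is a unit of \<open>R(T')\<close> (\<open>inverse_unit_plus_small\<close>). Let \<open>E\<close> be such an element.
  Then \<open>E \<cdot> f\<^sub>1 \<cdots> f\<^sub>m\<close> is a nonzero element of \<open>T'\<close>, so its reciprocal lies in \<open>R(T')\<close>. The factors
  \<open>f\<^sub>i\<close> are now removed from the denominator one at a time. By induction on \<open>m\<close> the shorter sum
  \<open>e = E - 1 / f\<^sub>i\<close> is a unit, and
  the identity \<open>y / E = (y - y / (f\<^sub>i E)) / e\<close>
  shows that \<open>y / (f\<^sub>i E) \<in> R(T')\<close> implies \<open>y / E \<in> R(T')\<close> for every \<open>y \<in> R(T')\<close>.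

  Uniqueness is general: a prime \<open>P\<close> of a domain \<open>R\<close> consists of those elements of \<open>R\<close> that are not
  units of \<open>R\<^sub>P\<close>, so it is determined by \<open>R\<^sub>P\<close> (\<open>prime_eq_nonunits_of_localization\<close>).
\<close>

section \<open>Subrings of a field\<close>

text \<open>
  A subring of a field is treated as a plain set with closure properties, so that the arithmetic of
  the ambient type is available; generated rings and fields are then least such sets.
\<close>

locale subring_set =
  fixes A :: "'a::field set"
  assumes one_mem: "1 \<in> A"
    and diff_mem: "x \<in> A \<Longrightarrow> y \<in> A \<Longrightarrow> x - y \<in> A"
    and mult_mem: "x \<in> A \<Longrightarrow> y \<in> A \<Longrightarrow> x * y \<in> A"
begin

lemma zero_mem: "0 \<in> A"
  using diff_mem[OF one_mem one_mem] by simp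

lemma uminus_mem: "x \<in> A \<Longrightarrow> - x \<in> A"
  using diff_mem[OF zero_mem] by simp

lemma add_mem: "x \<in> A \<Longrightarrow> y \<in> A \<Longrightarrow> x + y \<in> A"
  using diff_mem[OF _ uminus_mem] by fastforce

lemma sum_list_mem: "set xs \<subseteq> A \<Longrightarrow> sum_list xs \<in> A"
  by (induction xs) (auto simp: zero_mem add_mem)

lemma prod_list_mem: "set xs \<subseteq> A \<Longrightarrow> prod_list xs \<in> A"
  by (induction xs) (auto simp: one_mem mult_mem)

lemma prod_mem: "(\<And>i. i \<in> I \<Longrightarrow> f i \<in> A) \<Longrightarrow> prod f I \<in> A"
  by (induction I rule: infinite_finite_induct) (auto simp: one_mem mult_mem)

lemma power_mem: "x \<in> A \<Longrightarrow> x ^ k \<in> A"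
  by (induction k) (auto simp: one_mem mult_mem)

end

lemma ring_of_type_algebra_simps:
  "carrier (ring_of_type_algebra :: 'a::field ring) = UNIV"
  "x \<otimes>\<^bsub>ring_of_type_algebra\<^esub> y = x * (y :: 'a)"
  "x \<oplus>\<^bsub>ring_of_type_algebra\<^esub> y = x + (y :: 'a)"
  "\<one>\<^bsub>ring_of_type_algebra\<^esub> = (1 :: 'a)"
  "\<zero>\<^bsub>ring_of_type_algebra\<^esub> = (0 :: 'a)"
  by (simp_all add: ring_of_type_algebra_def)

lemma a_inv_ring_of_type_algebra: "\<ominus>\<^bsub>ring_of_type_algebra\<^esub> x = - (x :: 'a::field)"
proof -
  interpret ring "ring_of_type_algebra :: 'a ring" by (rule ring_from_type_algebra)
  show ?thesis
    by (rule minus_equality) (simp_all add: ring_of_type_algebra_simps)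
qed

lemma m_inv_ring_of_type_algebra:
  assumes "x \<noteq> 0"
  shows "inv\<^bsub>ring_of_type_algebra\<^esub> x = inverse (x :: 'a::field)"
proof -
  interpret cring "ring_of_type_algebra :: 'a ring" by (rule cring_from_type_algebra)
  show ?thesis
    by (rule comm_inv_char) (use assms in \<open>simp_all add: ring_of_type_algebra_simps\<close>)
qed

lemmas ring_of_type_algebra_ops =
  ring_of_type_algebra_simps a_inv_ring_of_type_algebra m_inv_ring_of_type_algebra

lemma subring_set_generate_ring:
  "subring_set (generate_ring (ring_of_type_algebra :: 'a::field ring) S)"
proof
  note rules = generate_ring.intros[where R = "ring_of_type_algebra :: 'a ring" and H = S,
      unfolded ring_of_type_algebra_ops]
  show "1 \<in> generate_ring (ring_of_type_algebra :: 'a ring) S"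
    by (rule rules)
  fix x y :: 'a
  assume xy: "x \<in> generate_ring ring_of_type_algebra S" "y \<in> generate_ring ring_of_type_algebra S"
  show "x * y \<in> generate_ring ring_of_type_algebra S"
    using xy by (rule rules)
  show "x - y \<in> generate_ring ring_of_type_algebra S"
    using rules(4)[OF xy(1) rules(3)[OF xy(2)]] by simp
qed

lemma generate_ring_least:
  fixes S B :: "'a::field set"
  assumes "subring_set B" "S \<subseteq> B"
  shows "generate_ring ring_of_type_algebra S \<subseteq> B"
proof
  interpret subring_set B by fact
  fix x assume "x \<in> generate_ring ring_of_type_algebra S"
  then show "x \<in> B"
    by induction
      (use assms(2) in \<open>auto simp: ring_of_type_algebra_ops one_mem uminus_mem add_mem mult_mem\<close>)
qed

lemma subring_set_adjoin: "subring_set (adjoin A S)"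
  unfolding adjoin_def by (rule subring_set_generate_ring)

lemma subset_adjoin: "A \<union> S \<subseteq> adjoin A S"
  unfolding adjoin_def by (auto intro: generate_ring.incl)

lemma adjoin_least: "subring_set B \<Longrightarrow> A \<union> S \<subseteq> B \<Longrightarrow> adjoin A S \<subseteq> B"
  unfolding adjoin_def by (rule generate_ring_least)

lemma subring_set_reciprocal_complement: "subring_set (reciprocal_complement T)"
  unfolding reciprocal_complement_def by (rule subring_set_generate_ring)

lemma inverse_mem_reciprocal_complement:
  "f \<in> T \<Longrightarrow> f \<noteq> 0 \<Longrightarrow> inverse f \<in> reciprocal_complement T"
  unfolding reciprocal_complement_def
  by (rule generate_ring.incl) (auto simp: inverse_eq_divide)

lemma reciprocal_complement_least:
  assumes "subring_set B" "\<And>f. f \<in> T \<Longrightarrow> f \<noteq> 0 \<Longrightarrow> inverse f \<in> B"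
  shows "reciprocal_complement T \<subseteq> B"
  unfolding reciprocal_complement_def
  by (rule generate_ring_least) (use assms in \<open>auto simp: inverse_eq_divide\<close>)

lemma reciprocal_complement_mono:
  "T \<subseteq> T' \<Longrightarrow> reciprocal_complement T \<subseteq> reciprocal_complement T'"
  by (rule reciprocal_complement_least)
    (auto simp: subring_set_reciprocal_complement intro: inverse_mem_reciprocal_complement)

lemma subring_set_adjoin_field: "subring_set (adjoin_field (A :: 'a::field set) S)"
proof
  note rules = generate_field.intros[where R = "ring_of_type_algebra :: 'a ring" and H = "A \<union> S",
      unfolded ring_of_type_algebra_ops, folded adjoin_field_def]
  show "1 \<in> adjoin_field A S"
    by (rule rules)
  fix x y :: 'a
  assume xy: "x \<in> adjoin_field A S" "y \<in> adjoin_field A S"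
  show "x * y \<in> adjoin_field A S"
    using xy by (rule rules)
  show "x - y \<in> adjoin_field A S"
    using rules(5)[OF xy(1) rules(3)[OF xy(2)]] by simp
qed

lemma inverse_mem_adjoin_field:
  assumes "x \<in> adjoin_field A S"
  shows "inverse x \<in> adjoin_field A S"
proof (cases "x = 0")
  case False
  then show ?thesis
    using generate_field.m_inv[of x "ring_of_type_algebra" "A \<union> S"] assms
    by (simp add: ring_of_type_algebra_ops adjoin_field_def)
qed (use assms in simp)

lemma subset_adjoin_field: "A \<union> S \<subseteq> adjoin_field A S"
  unfolding adjoin_field_def by (auto intro: generate_field.incl)

lemma adjoin_field_least:
  fixes B :: "'a::field set"
  assumes "subring_set B" "\<And>x. x \<in> B \<Longrightarrow> inverse x \<in> B" "A \<union> S \<subseteq> B"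
  shows "adjoin_field A S \<subseteq> B"
proof
  interpret subring_set B by fact
  fix x assume "x \<in> adjoin_field A S"
  then show "x \<in> B"
    unfolding adjoin_field_def
    by induction
      (use assms(2,3) in
        \<open>auto simp: ring_of_type_algebra_ops one_mem uminus_mem add_mem mult_mem\<close>)
qed

lemma adjoin_subset_adjoin_field: "adjoin A S \<subseteq> adjoin_field A S"
  by (rule adjoin_least[OF subring_set_adjoin_field subset_adjoin_field])


section \<open>Fractions\<close>

text \<open>
  A common generalization of the fraction field of \<open>T\<close>, where \<open>W = T\<close>, and of the ring of fractions
  of \<open>T\<close> with denominators in a smaller ring \<open>W\<close>.
\<close>

definition fractions :: "'a::field set \<Rightarrow> 'a set \<Rightarrow> 'a set" where
  "fractions T W = {t / w |t w. t \<in> T \<and> w \<in> W \<and> w \<noteq> 0}"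

lemma fractionsI: "t \<in> T \<Longrightarrow> w \<in> W \<Longrightarrow> w \<noteq> 0 \<Longrightarrow> t / w \<in> fractions T W"
  unfolding fractions_def by blast

lemma fractionsE:
  assumes "x \<in> fractions T W"
  obtains t w where "x = t / w" "t \<in> T" "w \<in> W" "w \<noteq> 0"
  using assms unfolding fractions_def by blast

lemma subset_fractions: "1 \<in> W \<Longrightarrow> T \<subseteq> fractions T W"
  using fractionsI[of _ T 1 W] by auto

lemma subring_set_fractions:
  assumes "subring_set T" "subring_set W" "W \<subseteq> T"
  shows "subring_set (fractions T W)"
proof -
  interpret T: subring_set T by fact
  interpret W: subring_set W by fact
  show ?thesis
  proof
    show "1 \<in> fractions T W"
      using subset_fractions[OF W.one_mem] T.one_mem by blast
  next
    fix x y assume "x \<in> fractions T W" "y \<in> fractions T W"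
    then obtain s v t w where x: "x = s / v" "s \<in> T" "v \<in> W" "v \<noteq> 0"
      and y: "y = t / w" "t \<in> T" "w \<in> W" "w \<noteq> 0"
      by (elim fractionsE)
    have "x * y = (s * t) / (v * w)" "x - y = (s * w - t * v) / (v * w)"
      using x y by (simp_all add: diff_frac_eq)
    moreover have "v * w \<in> W" "v * w \<noteq> 0"
      using x y by (simp_all add: W.mult_mem)
    moreover have "s * t \<in> T" "s * w - t * v \<in> T"
      using x y \<open>W \<subseteq> T\<close> by (meson T.diff_mem T.mult_mem subsetD)+
    ultimately show "x * y \<in> fractions T W" "x - y \<in> fractions T W"
      by (metis fractionsI)+
  qed
qed

lemma adjoin_field_eq_fractions:
  "adjoin_field A S = fractions (adjoin A S) (adjoin A S)"
proof
  interpret T: subring_set "adjoin A S" by (rule subring_set_adjoin)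
  interpret F: subring_set "adjoin_field A S" by (rule subring_set_adjoin_field)
  note incl = subset_fractions[OF T.one_mem]
  show "adjoin_field A S \<subseteq> fractions (adjoin A S) (adjoin A S)"
  proof (rule adjoin_field_least)
    show "subring_set (fractions (adjoin A S) (adjoin A S))"
      by (intro subring_set_fractions subring_set_adjoin order_refl)
    show "A \<union> S \<subseteq> fractions (adjoin A S) (adjoin A S)"
      using subset_adjoin incl by (rule order_trans)
    fix x assume "x \<in> fractions (adjoin A S) (adjoin A S)"
    then obtain p q where pq: "x = p / q" "p \<in> adjoin A S" "q \<in> adjoin A S" "q \<noteq> 0"
      by (elim fractionsE)
    show "inverse x \<in> fractions (adjoin A S) (adjoin A S)"
    proof (cases "p = 0")
      case True
      then show ?thesis using incl T.zero_mem pq by auto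
    next
      case False
      then show ?thesis using fractionsI[of q "adjoin A S" p] pq by simp
    qed
  qed
  show "fractions (adjoin A S) (adjoin A S) \<subseteq> adjoin_field A S"
    using adjoin_subset_adjoin_field[of A S]
    by (auto elim!: fractionsE simp: divide_inverse intro!: F.mult_mem inverse_mem_adjoin_field)
qed

lemma adjoin_adjoin_field_eq_fractions:
  "adjoin (adjoin_field A S) S' = fractions (adjoin A (S \<union> S')) (adjoin A S)"
proof
  interpret W: subring_set "adjoin A S" by (rule subring_set_adjoin)
  interpret T': subring_set "adjoin (adjoin_field A S) S'" by (rule subring_set_adjoin)
  have WT: "adjoin A S \<subseteq> adjoin A (S \<union> S')"
    using subset_adjoin[of A "S \<union> S'"] by (intro adjoin_least subring_set_adjoin) auto
  show "adjoin (adjoin_field A S) S' \<subseteq> fractions (adjoin A (S \<union> S')) (adjoin A S)"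
  proof (rule adjoin_least[OF subring_set_fractions Un_least])
    show "adjoin_field A S \<subseteq> fractions (adjoin A (S \<union> S')) (adjoin A S)"
      unfolding adjoin_field_eq_fractions using WT by (auto elim!: fractionsE intro!: fractionsI)
    show "S' \<subseteq> fractions (adjoin A (S \<union> S')) (adjoin A S)"
      using subset_adjoin[of A "S \<union> S'"] subset_fractions[OF W.one_mem] by blast
  qed (rule subring_set_adjoin WT)+
  have "adjoin A (S \<union> S') \<subseteq> adjoin (adjoin_field A S) S'"
    using subset_adjoin[of "adjoin_field A S" S'] subset_adjoin_field[of A S]
    by (intro adjoin_least subring_set_adjoin) auto
  moreover have "inverse w \<in> adjoin (adjoin_field A S) S'" if "w \<in> adjoin A S" for w
    using that subset_adjoin[of "adjoin_field A S" S'] adjoin_subset_adjoin_field[of A S]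
      inverse_mem_adjoin_field[of w A S]
    by blast
  ultimately show "fractions (adjoin A (S \<union> S')) (adjoin A S) \<subseteq> adjoin (adjoin_field A S) S'"
    by (auto elim!: fractionsE simp: divide_inverse intro!: T'.mult_mem)
qed

text \<open>
  Enlarging \<open>T\<close> by denominators \<open>w\<close> multiplies its reciprocals by the elements \<open>w\<close>, so the
  reciprocal complement changes by a localization: the elements \<open>1 / w\<close>, which belong to
  \<open>R(T)\<close> because \<open>W \<subseteq> T\<close>, become invertible. The same inclusion provides the common denominators
  for sums: \<open>a v - b w = (a / w - b / v) v w\<close>.
\<close>

lemma reciprocal_complement_fractions:
  fixes T W :: "'a::field set"
  assumes "subring_set T" "subring_set W" "W \<subseteq> T"
  shows "reciprocal_complement (fractions T W) =
    {a * w |a w. a \<in> reciprocal_complement T \<and> w \<in> W \<and> w \<noteq> 0}"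
    (is "_ = ?S")
proof
  interpret T: subring_set T by fact
  interpret W: subring_set W by fact
  interpret R: subring_set "reciprocal_complement T" by (rule subring_set_reciprocal_complement)
  interpret R': subring_set "reciprocal_complement (fractions T W)"
    by (rule subring_set_reciprocal_complement)
  have SI: "a * w \<in> ?S" if "a \<in> reciprocal_complement T" "w \<in> W" "w \<noteq> 0" for a w
    using that by blast
  show "reciprocal_complement (fractions T W) \<subseteq> ?S"
  proof (rule reciprocal_complement_least)
    show "subring_set ?S"
    proof
      show "1 \<in> ?S"
        using SI[OF R.one_mem W.one_mem] by simp
    next
      fix x y assume "x \<in> ?S" "y \<in> ?S"
      then obtain a v b w where x: "x = a * v" "a \<in> reciprocal_complement T" "v \<in> W" "v \<noteq> 0"
        and y: "y = b * w" "b \<in> reciprocal_complement T" "w \<in> W" "w \<noteq> 0"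
        by blast
      have inv: "inverse v \<in> reciprocal_complement T" "inverse w \<in> reciprocal_complement T"
        using x y \<open>W \<subseteq> T\<close> by (auto intro: inverse_mem_reciprocal_complement)
      have vw: "v * w \<in> W" "v * w \<noteq> 0"
        using x y by (auto intro: W.mult_mem)
      have "(a * b) * (v * w) \<in> ?S"
        using x y by (intro SI vw R.mult_mem)
      also have "(a * b) * (v * w) = x * y"
        using x y by simp
      finally show "x * y \<in> ?S" .
      have "(a * inverse w - b * inverse v) * (v * w) \<in> ?S"
        using x y by (intro SI vw R.diff_mem R.mult_mem inv)
      also have "(a * inverse w - b * inverse v) * (v * w) = x - y"
        using x y by (simp add: left_diff_distrib) (simp add: field_simps)
      finally show "x - y \<in> ?S" .
    qed
    fix f assume "f \<in> fractions T W" "f \<noteq> 0"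
    then obtain t w where f: "f = t / w" "t \<in> T" "t \<noteq> 0" "w \<in> W" "w \<noteq> 0"
      by (auto elim!: fractionsE)
    then have "inverse t * w \<in> ?S"
      by (intro SI inverse_mem_reciprocal_complement)
    then show "inverse f \<in> ?S"
      using f(1) by (simp add: divide_inverse mult.commute)
  qed
  have RR': "reciprocal_complement T \<subseteq> reciprocal_complement (fractions T W)"
    by (intro reciprocal_complement_mono subset_fractions W.one_mem)
  have "w \<in> reciprocal_complement (fractions T W)" if "w \<in> W" "w \<noteq> 0" for w
    using inverse_mem_reciprocal_complement[OF fractionsI[OF T.one_mem that]] that by simp
  then show "?S \<subseteq> reciprocal_complement (fractions T W)"
    using RR' by (auto intro!: R'.mult_mem)
qed


section \<open>Locality of the reciprocal complement\<close>

text \<open>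
  Products and negatives of reciprocals are reciprocals, so sums of reciprocals already form a ring.
\<close>

lemma (in subring_set) reciprocal_complement_sum_of_reciprocals:
  assumes "x \<in> reciprocal_complement A"
  obtains fs where "set fs \<subseteq> A - {0}" "x = sum_list (map inverse fs)"
proof -
  define B where "B = {sum_list (map inverse fs) |fs. set fs \<subseteq> A - {0}}"
  have BI: "x \<in> B" if "set fs \<subseteq> A - {0}" "x = sum_list (map inverse fs)" for x fs
    using that unfolding B_def by blast
  have "subring_set B"
  proof
    show "1 \<in> B"
      by (rule BI[of "[1]"]) (auto simp: one_mem)
  next
    fix x y assume "x \<in> B" "y \<in> B"
    then obtain fs gs where x: "x = sum_list (map inverse fs)" "set fs \<subseteq> A - {0}"
      and y: "y = sum_list (map inverse gs)" "set gs \<subseteq> A - {0}"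
      unfolding B_def by blast
    have "sum_list (map (inverse \<circ> uminus) gs) = - sum_list (map inverse gs)"
      by (induction gs) simp_all
    then show "x - y \<in> B"
      using x y uminus_mem by (intro BI[of "fs @ map uminus gs"]) auto
    have "sum_list (map (\<lambda>g. inverse (f * g)) gs) = inverse f * sum_list (map inverse gs)" for f
      by (induction gs) (simp_all add: algebra_simps)
    then have "sum_list (map inverse (concat (map (\<lambda>f. map ((*) f) gs) fs))) = x * y"
      unfolding x y by (induction fs) (simp_all add: algebra_simps comp_def)
    then show "x * y \<in> B"
      using x y mult_mem by (intro BI[of "concat (map (\<lambda>f. map ((*) f) gs) fs)"]) auto
  qed
  moreover have "inverse f \<in> B" if "f \<in> A" "f \<noteq> 0" for f
    by (rule BI[of "[f]"]) (use that in auto)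
  ultimately have "reciprocal_complement A \<subseteq> B"
    by (rule reciprocal_complement_least)
  then show thesis
    using assms that unfolding B_def by blast
qed

lemma (in subring_set) clear_reciprocals:
  assumes "c \<in> A" "set fs \<subseteq> A - {0}"
  shows "(c + sum_list (map inverse fs)) * prod_list fs \<in> A"
  using assms(2)
proof (induction fs)
  case Nil
  then show ?case using assms(1) by simp
next
  case (Cons f fs)
  have "(c + sum_list (map inverse (f # fs))) * prod_list (f # fs) =
      f * ((c + sum_list (map inverse fs)) * prod_list fs) + prod_list fs"
    using Cons.prems by (simp add: field_simps)
  moreover have "(c + sum_list (map inverse fs)) * prod_list fs \<in> A" "prod_list fs \<in> A"
    using Cons by (auto intro: prod_list_mem)
  ultimately show ?case
    using Cons.prems by (auto intro!: add_mem mult_mem)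
qed

text \<open>
  The locality argument for \<open>R(T)\<close> uses only the following situation. \<open>L\<close> is a field of constants
  inside \<open>T\<close>, and \<open>M\<close> is a collection of elements regarded as small: it contains the reciprocals
  of all nonconstant elements, but not \<open>1\<close>. For \<open>T = L[X\<^sub>1, \<dots>, X\<^sub>j]\<close> small means of negative
  degree. The axioms make \<open>L + M\<close> a ring that contains \<open>R(T)\<close> and has \<open>M\<close> as a maximal ideal.
  They do not assert that elements outside \<open>M\<close> are units; for \<open>R(T)\<close> that is proved below.
\<close>

locale small_reciprocals = T: subring_set T + L: subring_set L
  for T L :: "'a::field set" +
  fixes M :: "'a set"
  assumes L_subset: "L \<subseteq> T"
    and L_inverse: "x \<in> L \<Longrightarrow> inverse x \<in> L"
    and M_zero: "0 \<in> M"
    and M_one: "1 \<notin> M"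
    and M_add: "x \<in> M \<Longrightarrow> y \<in> M \<Longrightarrow> x + y \<in> M"
    and M_mult: "x \<in> M \<Longrightarrow> y \<in> M \<Longrightarrow> x * y \<in> M"
    and M_scale: "c \<in> L \<Longrightarrow> x \<in> M \<Longrightarrow> c * x \<in> M"
    and M_inverse: "f \<in> T \<Longrightarrow> f \<notin> L \<Longrightarrow> inverse f \<in> M"
begin

sublocale R: subring_set "reciprocal_complement T"
  by (rule subring_set_reciprocal_complement)

lemma sum_reciprocals_mem_M: "set fs \<subseteq> T - L \<Longrightarrow> sum_list (map inverse fs) \<in> M"
  by (induction fs) (auto simp: M_zero intro: M_add M_inverse)

lemma L_inter_M: "c \<in> L \<Longrightarrow> c \<in> M \<Longrightarrow> c = 0"
  using M_scale[OF L_inverse, of c c] M_one by (cases "c = 0") auto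

text \<open>The reciprocals of the constants among the denominators add up to the constant \<open>c\<close>.\<close>

lemma reciprocal_complement_decompose:
  assumes "x \<in> reciprocal_complement T"
  obtains c fs where "c \<in> L" "set fs \<subseteq> T - L" "x = c + sum_list (map inverse fs)"
proof -
  obtain gs where gs: "set gs \<subseteq> T - {0}" "x = sum_list (map inverse gs)"
    using T.reciprocal_complement_sum_of_reciprocals[OF assms] .
  have "x = sum_list (map inverse (filter (\<lambda>g. g \<in> L) gs)) +
      sum_list (map inverse (filter (\<lambda>g. g \<notin> L) gs))"
    unfolding gs(2) by (induction gs) (simp_all add: algebra_simps)
  then show thesis
    using gs(1) by (intro that[OF L.sum_list_mem, of "map inverse (filter (\<lambda>g. g \<in> L) gs)"
          "filter (\<lambda>g. g \<notin> L) gs"]) (auto intro: L_inverse)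
qed

text \<open>
  The key step. For \<open>E = c + 1 / f\<^sub>1 + \<dots> + 1 / f\<^sub>m\<close> the only reciprocal with denominator related
  to \<open>E\<close> that is visibly in \<open>R(T)\<close> is \<open>1 / (E f\<^sub>1 \<cdots> f\<^sub>m)\<close>. In the inner induction \<open>gs\<close> lists the factors
  \<open>f\<^sub>i\<close> still present in the denominator, and the outer induction on the number of summands makes the
  sum \<open>e\<close> obtained from \<open>E\<close> by dropping one summand a unit.
\<close>

lemma inverse_unit_plus_small:
  assumes "c \<in> L" "c \<noteq> 0" "set fs \<subseteq> T - L"
  shows "inverse (c + sum_list (map inverse fs)) \<in> reciprocal_complement T"
  using assms(3)
proof (induction fs rule: length_induct)
  case (1 fs)
  define E where "E = c + sum_list (map inverse fs)"
  have nz: "f \<noteq> 0" if "f \<in> T - L" for f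
    using that L.zero_mem by auto
  have nonzero: "c + sum_list (map inverse gs) \<noteq> 0" if gs: "set gs \<subseteq> T - L" for gs
  proof
    assume "c + sum_list (map inverse gs) = 0"
    then have "c = (- 1) * sum_list (map inverse gs)"
      by (simp add: eq_neg_iff_add_eq_0)
    then have "c \<in> M"
      using M_scale[OF L.uminus_mem[OF L.one_mem] sum_reciprocals_mem_M[OF gs]] by simp
    then show False
      using L_inter_M assms by blast
  qed
  have E: "E \<noteq> 0"
    using nonzero 1 unfolding E_def by blast
  have "inverse (E * prod_list gs) \<in> reciprocal_complement T" if "fs = hs @ gs" for hs gs
    using that
  proof (induction hs arbitrary: gs rule: rev_induct)
    case Nil
    have "prod_list gs \<noteq> 0"
      using nz 1(2) Nil by (auto simp: prod_list_zero_iff)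
    then have "E * prod_list gs \<noteq> 0"
      using E by simp
    moreover have "E * prod_list gs \<in> T"
      using T.clear_reciprocals[of c gs] assms(1) L_subset 1(2) Nil nz unfolding E_def by auto
    ultimately show ?case
      by (intro inverse_mem_reciprocal_complement)
  next
    case (snoc f hs)
    define e where "e = c + sum_list (map inverse (hs @ gs))"
    define y where "y = inverse (prod_list gs)"
    have f: "f \<noteq> 0" and small: "set (hs @ gs) \<subseteq> T - L"
      using nz 1(2) snoc.prems by auto
    have e: "e \<noteq> 0" "inverse e \<in> reciprocal_complement T"
      using nonzero[OF small] 1(1)[rule_format, of "hs @ gs"] small snoc.prems
      unfolding e_def by simp_all
    have "prod_list gs \<in> T" "prod_list gs \<noteq> 0"
      using small nz by (auto intro!: T.prod_list_mem simp: prod_list_zero_iff)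
    then have y: "y \<in> reciprocal_complement T"
      unfolding y_def by (rule inverse_mem_reciprocal_complement)
    have "inverse (E * prod_list (f # gs)) \<in> reciprocal_complement T"
      using snoc by simp
    then have "inverse e * (y - inverse (E * prod_list (f # gs))) \<in> reciprocal_complement T"
      by (intro R.mult_mem R.diff_mem e y)
    also have "inverse (E * prod_list (f # gs)) = inverse E * (inverse f * y)"
      unfolding y_def by simp
    \<comment> \<open>Since \<open>1 / f = E - e\<close>, subtracting \<open>y / (f E)\<close> from \<open>y\<close> leaves \<open>e y / E\<close>.\<close>
    also have "inverse f = E - e"
      unfolding E_def e_def using snoc.prems by simp
    also have "y - inverse E * ((E - e) * y) = e * (inverse E * y)"
      using E by (simp add: right_diff_distrib left_diff_distrib)
    also have "inverse e * (e * (inverse E * y)) = inverse (E * prod_list gs)"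
      using e(1) unfolding y_def by simp
    finally show ?case .
  qed
  from this[of fs "[]"] show ?case
    unfolding E_def by simp
qed

lemma inverse_mem_of_not_small:
  assumes "x \<in> reciprocal_complement T" "x \<notin> M"
  shows "inverse x \<in> reciprocal_complement T"
proof -
  obtain c fs where *: "c \<in> L" "set fs \<subseteq> T - L" "x = c + sum_list (map inverse fs)"
    using reciprocal_complement_decompose[OF assms(1)] .
  then have "c \<noteq> 0"
    using assms(2) sum_reciprocals_mem_M by auto
  then show ?thesis
    using * inverse_unit_plus_small by simp
qed

text \<open>Since \<open>R(T) \<subseteq> L + M\<close>, the small elements of \<open>R(T)\<close> form an ideal.\<close>

lemma M_absorb:
  assumes "x \<in> reciprocal_complement T" "y \<in> M"
  shows "x * y \<in> M"
proof -
  obtain c fs where *: "c \<in> L" "set fs \<subseteq> T - L" "x = c + sum_list (map inverse fs)"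
    using reciprocal_complement_decompose[OF assms(1)] .
  then show ?thesis
    using assms(2) sum_reciprocals_mem_M[OF *(2)]
    by (simp add: distrib_right M_add M_mult M_scale)
qed

end


section \<open>Prime ideals and localizations\<close>

lemma ring_on_simps:
  "carrier (ring_on A) = A"
  "x \<otimes>\<^bsub>ring_on A\<^esub> y = x * y"
  "x \<oplus>\<^bsub>ring_on A\<^esub> y = x + y"
  "\<one>\<^bsub>ring_on A\<^esub> = 1"
  "\<zero>\<^bsub>ring_on A\<^esub> = 0"
  by (simp_all add: ring_on_def ring_of_type_algebra_def)

lemma (in subring_set) cring_ring_on: "cring (ring_on A)"
proof (rule cringI)
  show "abelian_group (ring_on A)"
    by (rule abelian_groupI)
      (auto simp: ring_on_simps add_mem zero_mem algebra_simps intro!: bexI[OF _ uminus_mem])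
  show "comm_monoid (ring_on A)"
    by (rule comm_monoidI) (auto simp: ring_on_simps mult_mem one_mem algebra_simps)
qed (simp add: ring_on_simps algebra_simps)

lemma (in subring_set) primeideal_ring_onI:
  assumes "P \<subseteq> A" "0 \<in> P" "1 \<notin> P"
    and add: "\<And>x y. x \<in> P \<Longrightarrow> y \<in> P \<Longrightarrow> x + y \<in> P"
    and absorb: "\<And>x y. x \<in> A \<Longrightarrow> y \<in> P \<Longrightarrow> x * y \<in> P"
    and prime: "\<And>x y. x \<in> A \<Longrightarrow> y \<in> A \<Longrightarrow> x * y \<in> P \<Longrightarrow> x \<in> P \<or> y \<in> P"
  shows "primeideal P (ring_on A)"
proof -
  interpret C: cring "ring_on A" by (rule cring_ring_on)
  have minus: "\<ominus>\<^bsub>ring_on A\<^esub> x = - x" if "x \<in> A" for x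
    by (rule C.minus_equality) (use that in \<open>auto simp: ring_on_simps uminus_mem\<close>)
  have "ideal P (ring_on A)"
  proof (rule idealI)
    show "subgroup P (add_monoid (ring_on A))"
    proof (rule group.subgroupI)
      show "group (add_monoid (ring_on A))"
        by (rule C.a_group)
      fix x assume "x \<in> P"
      then have "- x \<in> P"
        using absorb[of "- 1" x] uminus_mem[OF one_mem] by simp
      then show "inv\<^bsub>add_monoid (ring_on A)\<^esub> x \<in> P"
        using minus[of x] \<open>x \<in> P\<close> assms(1) by (auto simp: a_inv_def)
    qed (use assms in \<open>auto simp: ring_on_simps\<close>)
  next
    fix a x assume "a \<in> P" "x \<in> carrier (ring_on A)"
    then show "x \<otimes>\<^bsub>ring_on A\<^esub> a \<in> P" "a \<otimes>\<^bsub>ring_on A\<^esub> x \<in> P"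
      using absorb[of x a] by (simp_all add: ring_on_simps mult.commute)
  qed (rule C.ring_axioms)
  then show ?thesis
    by (rule primeidealI) (use assms one_mem prime in \<open>auto simp: ring_on_simps C.cring_axioms\<close>)
qed

text \<open>
  If \<open>x \<in> Q\<close> had an inverse \<open>a / s\<close> in the localization, then \<open>s = a x\<close> would be in \<open>Q\<close>. The right
  side mentions \<open>Q\<close> only through its localization, so two primes with the same localization are equal.
\<close>

lemma prime_eq_nonunits_of_localization:
  assumes "primeideal Q (ring_on A)" "1 \<in> A"
  shows "Q = {x \<in> A. x = 0 \<or> inverse x \<notin> localization_at A Q}"
proof -
  interpret primeideal Q "ring_on A" by fact
  have sub: "Q \<subseteq> A"
    using a_subset by (simp add: ring_on_simps)
  have zero: "0 \<in> Q"
    using additive_subgroup.zero_closed[OF additive_subgroup_axioms] by (simp add: ring_on_simps)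
  have "x \<in> Q \<longleftrightarrow> x = 0 \<or> inverse x \<notin> localization_at A Q" if "x \<in> A" for x
  proof (cases "x = 0")
    case False
    have False if "x \<in> Q" "inverse x \<in> localization_at A Q"
    proof -
      obtain a s where as: "inverse x = a / s" "a \<in> A" "s \<in> A" "s \<notin> Q"
        using \<open>inverse x \<in> localization_at A Q\<close> unfolding localization_at_def by blast
      have "s \<noteq> 0" using as zero by auto
      then have "s = a * x"
        using as(1) False by (simp add: field_simps)
      then show False
        using I_l_closed[of x a] \<open>x \<in> Q\<close> as by (simp add: ring_on_simps)
    qed
    moreover have "inverse x \<in> localization_at A Q" if "x \<notin> Q"
      using that \<open>x \<in> A\<close> assms(2) unfolding localization_at_def
      by (auto simp: inverse_eq_divide)
    ultimately show ?thesis using False by blast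
  qed (use zero in simp)
  then show ?thesis
    using sub by blast
qed


section \<open>Degrees of rational functions\<close>

lemma poly_mapping_sum_single:
  fixes p :: "'a \<Rightarrow>\<^sub>0 'b::comm_monoid_add"
  shows "(\<Sum>a\<in>Poly_Mapping.keys p. Poly_Mapping.single a (Poly_Mapping.lookup p a)) = p"
  by (rule poly_mapping_eqI)
    (auto simp: Poly_Mapping.lookup_sum Poly_Mapping.lookup_single when_def
      sum.delta[OF finite_keys] in_keys_iff)

lemma poly_mapping_additive_induct [case_names zero single add]:
  fixes p :: "'a \<Rightarrow>\<^sub>0 'b::comm_monoid_add"
  assumes "P 0" "\<And>a c. P (Poly_Mapping.single a c)" "\<And>p q. P p \<Longrightarrow> P q \<Longrightarrow> P (p + q)"
  shows "P p"
proof -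
  have "P (\<Sum>a\<in>A. Poly_Mapping.single a (Poly_Mapping.lookup p a))" for A
    by (induction A rule: infinite_finite_induct) (auto intro: assms)
  then show ?thesis
    using poly_mapping_sum_single[of p] by metis
qed

type_synonym 'k mpoly = "(nat \<Rightarrow>\<^sub>0 nat) \<Rightarrow>\<^sub>0 'k"

definition exponent_sum :: "nat set \<Rightarrow> (nat \<Rightarrow>\<^sub>0 nat) \<Rightarrow> nat" where
  "exponent_sum J a = (\<Sum>i\<in>J. Poly_Mapping.lookup a i)"

text \<open>
  The substitution \<open>X\<^sub>i \<mapsto> X\<^sub>i t\<close> for \<open>i \<in> J\<close>, with a new variable \<open>t\<close>. It turns the total degree in the
  variables \<open>X\<^sub>i\<close>, \<open>i \<in> J\<close>, into the degree in \<open>t\<close> of a polynomial in one variable over a domain,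
  for which additivity on products is known.
\<close>

definition homogenize :: "nat set \<Rightarrow> 'k::field mpoly \<Rightarrow> 'k mpoly poly" where
  "homogenize J p = (\<Sum>a\<in>Poly_Mapping.keys p.
    monom (Poly_Mapping.single a (Poly_Mapping.lookup p a)) (exponent_sum J a))"

lemma homogenize_add: "homogenize J (p + q) = homogenize J p + homogenize J q"
  unfolding homogenize_def
  by (rule setsum_keys_plus_distrib) (simp_all add: single_add add_monom)

lemma homogenize_zero [simp]: "homogenize J 0 = 0"
  by (simp add: homogenize_def)

lemma homogenize_single:
  "homogenize J (Poly_Mapping.single a c) = monom (Poly_Mapping.single a c) (exponent_sum J a)"
  by (simp add: homogenize_def)

lemma exponent_sum_add: "exponent_sum J (a + b) = exponent_sum J a + exponent_sum J b"
  by (simp add: exponent_sum_def lookup_add sum.distrib)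

lemma homogenize_mult: "homogenize J (p * q) = homogenize J p * homogenize J q"
proof (induction p rule: poly_mapping_additive_induct)
  case (single a c)
  show ?case
    by (induction q rule: poly_mapping_additive_induct)
      (simp_all add: homogenize_single homogenize_add mult_single mult_monom exponent_sum_add
        distrib_left)
qed (simp_all add: homogenize_add distrib_right)

text \<open>The substitution \<open>t = 1\<close> undoes the homogenization, which is therefore injective.\<close>

lemma poly_homogenize_1: "poly (homogenize J p) 1 = p"
  by (simp add: homogenize_def poly_sum poly_monom poly_mapping_sum_single)

definition partial_degree :: "nat set \<Rightarrow> 'k::field mpoly \<Rightarrow> nat" where
  "partial_degree J p = degree (homogenize J p)"

lemma homogenize_eq_0_iff [simp]: "homogenize J p = 0 \<longleftrightarrow> p = 0"
  using poly_homogenize_1[of J p] by auto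

lemma partial_degree_mult:
  "p \<noteq> 0 \<Longrightarrow> q \<noteq> 0 \<Longrightarrow> partial_degree J (p * q) = partial_degree J p + partial_degree J q"
  by (simp add: partial_degree_def homogenize_mult degree_mult_eq)

lemma partial_degree_add_less:
  "partial_degree J p < d \<Longrightarrow> partial_degree J q < d \<Longrightarrow> partial_degree J (p + q) < d"
  by (simp add: partial_degree_def homogenize_add degree_add_less)

lemma partial_degree_eq_0_iff:
  "partial_degree J p = 0 \<longleftrightarrow> (\<forall>a\<in>Poly_Mapping.keys p. exponent_sum J a = 0)"
proof
  assume "\<forall>a\<in>Poly_Mapping.keys p. exponent_sum J a = 0"
  then have "degree (homogenize J p) \<le> 0"
    unfolding homogenize_def
    by (intro degree_sum_le) (use degree_monom_le[of _ 0] in auto)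
  then show "partial_degree J p = 0"
    by (simp add: partial_degree_def)
next
  assume deg: "partial_degree J p = 0"
  show "\<forall>a\<in>Poly_Mapping.keys p. exponent_sum J a = 0"
  proof
    fix a assume a: "a \<in> Poly_Mapping.keys p"
    have "Poly_Mapping.lookup (coeff (homogenize J p) (exponent_sum J a)) a =
        (\<Sum>b\<in>Poly_Mapping.keys p. if b = a then Poly_Mapping.lookup p b else 0)"
      unfolding homogenize_def coeff_sum Poly_Mapping.lookup_sum
      by (intro sum.cong) (auto simp: Poly_Mapping.lookup_single when_def)
    also have "\<dots> = Poly_Mapping.lookup p a"
      using a by simp
    finally have "coeff (homogenize J p) (exponent_sum J a) \<noteq> 0"
      using a by (auto simp: in_keys_iff)
    then have "exponent_sum J a \<le> partial_degree J p"
      unfolding partial_degree_def by (rule le_degree)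
    then show "exponent_sum J a = 0"
      using deg by simp
  qed
qed

text \<open>
  The degree of a fraction \<open>p / q\<close> is the degree of \<open>p\<close> minus that of \<open>q\<close>. Zero is listed separately
  because \<open>partial_degree\<close> takes the value \<open>0\<close>, not minus infinity, at the zero polynomial.
\<close>

definition negative_degree :: "nat set \<Rightarrow> 'k::field ratfun set" where
  "negative_degree J =
    {Fract p q |p q. q \<noteq> 0 \<and> (p = 0 \<or> partial_degree J p < partial_degree J q)}"

lemma negative_degreeI:
  "q \<noteq> 0 \<Longrightarrow> p \<noteq> 0 \<Longrightarrow> partial_degree J p < partial_degree J q \<Longrightarrow> Fract p q \<in> negative_degree J"
  unfolding negative_degree_def by blast

lemma zero_mem_negative_degree: "0 \<in> negative_degree J"
  unfolding negative_degree_def by (intro CollectI exI[of _ 0] exI[of _ 1]) (simp add: fract_collapse)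

lemma negative_degree_cases:
  assumes "x \<in> negative_degree J"
  obtains "x = 0"
  | p q where "x = Fract p q" "p \<noteq> 0" "q \<noteq> 0" "partial_degree J p < partial_degree J q"
proof -
  obtain p q where "x = Fract p q" "q \<noteq> 0" "p = 0 \<or> partial_degree J p < partial_degree J q"
    using assms unfolding negative_degree_def by blast
  then show thesis
    using that by (cases "p = 0") (auto simp: fract_collapse)
qed

lemma one_notin_negative_degree: "1 \<notin> negative_degree J"
proof
  assume "1 \<in> (negative_degree J :: 'a ratfun set)"
  then show False
  proof (cases rule: negative_degree_cases)
    case (2 p q)
    then show ?thesis by (simp add: One_fract_def eq_fract)
  qed simp
qed

lemma add_mem_negative_degree:
  assumes "x \<in> negative_degree J" "y \<in> negative_degree J"
  shows "x + y \<in> negative_degree J"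
  using assms(1)
proof (cases rule: negative_degree_cases)
  case 1
  then show ?thesis using assms(2) by simp
next
  case (2 p q)
  note x = this
  show ?thesis
    using assms(2)
  proof (cases rule: negative_degree_cases)
    case 1
    then show ?thesis using assms(1) by simp
  next
    case (2 r s)
    have "partial_degree J (p * s + r * q) < partial_degree J (q * s)"
      using x 2 by (intro partial_degree_add_less) (simp_all add: partial_degree_mult)
    then show ?thesis
      using x 2 negative_degreeI[of "q * s" "p * s + r * q" J] zero_mem_negative_degree[of J]
      by (cases "p * s + r * q = 0") (simp_all add: fract_collapse)
  qed
qed

lemma mult_mem_negative_degree:
  assumes "q \<noteq> 0" "partial_degree J p \<le> partial_degree J q" "y \<in> negative_degree J"
  shows "Fract p q * y \<in> negative_degree J"
  using assms(3)
proof (cases rule: negative_degree_cases)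
  case (2 r s)
  show ?thesis
  proof (cases "p = 0")
    case False
    then show ?thesis
      using 2 assms(1,2) negative_degreeI[of "q * s" "p * r" J] by (simp add: partial_degree_mult)
  qed (simp add: fract_collapse zero_mem_negative_degree)
qed (simp add: zero_mem_negative_degree)

section \<open>Polynomial rings inside the field of rational functions\<close>

text \<open>
  The generated ring \<open>K[X\<^sub>i, i \<in> I]\<close> consists of the polynomials whose monomials involve only
  variables with index in \<open>I\<close>. This is what connects degrees with membership in generated rings.
\<close>

lemma adjoin_indet_eq:
  "adjoin (range scalar) (indet ` I) =
    {Fract p 1 |p :: 'k::field mpoly. \<forall>a\<in>Poly_Mapping.keys p. Poly_Mapping.keys a \<subseteq> I}"
  (is "_ = ?U")
proof
  show "adjoin (range scalar) (indet ` I) \<subseteq> ?U"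
  proof (rule adjoin_least)
    show "subring_set ?U"
    proof
      show "1 \<in> ?U"
        by (auto simp: One_fract_def intro!: exI[of _ 1])
    next
      fix x y assume "x \<in> ?U" "y \<in> ?U"
      then obtain p q where p: "x = Fract p 1" "\<forall>a\<in>Poly_Mapping.keys p. Poly_Mapping.keys a \<subseteq> I"
        and q: "y = Fract q 1" "\<forall>a\<in>Poly_Mapping.keys q. Poly_Mapping.keys a \<subseteq> I"
        by blast
      have "\<forall>a\<in>Poly_Mapping.keys (p - q). Poly_Mapping.keys a \<subseteq> I"
        using keys_diff[of p q] p q by blast
      moreover have "x - y = Fract (p - q) 1"
        using p q by simp
      ultimately show "x - y \<in> ?U" by blast
      have "Poly_Mapping.keys (a + b) \<subseteq> I"
        if "a \<in> Poly_Mapping.keys p" "b \<in> Poly_Mapping.keys q" for a b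
        using Poly_Mapping.keys_add[of a b] that p q by blast
      then have "\<forall>a\<in>Poly_Mapping.keys (p * q). Poly_Mapping.keys a \<subseteq> I"
        using keys_mult[of p q] by blast
      moreover have "x * y = Fract (p * q) 1"
        using p q by simp
      ultimately show "x * y \<in> ?U" by blast
    qed
    have "scalar c \<in> ?U" for c :: 'k
      unfolding scalar_def by (intro CollectI exI conjI) (rule refl, simp)
    moreover have "indet i \<in> ?U" if "i \<in> I" for i
      unfolding indet_def using that by (intro CollectI exI conjI) (rule refl, simp)
    ultimately show "range scalar \<union> indet ` I \<subseteq> ?U" by blast
  qed
  define A where "A = adjoin (range (scalar :: 'k \<Rightarrow> _)) (indet ` I)"
  interpret A: subring_set A
    unfolding A_def by (rule subring_set_adjoin)
  have gen: "scalar c \<in> A"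
    "i \<in> I \<Longrightarrow> indet i \<in> A" for c :: 'k and i
    using subset_adjoin[of "range (scalar :: 'k \<Rightarrow> _)" "indet ` I"] unfolding A_def by auto
  have Fract_add: "Fract (p + q) 1 = Fract p 1 + Fract q 1" for p q :: "'k mpoly"
    by simp
  have Fract_mult: "Fract (p * q) 1 = Fract p 1 * Fract q 1" for p q :: "'k mpoly"
    by simp
  have power: "Fract (Poly_Mapping.single (Poly_Mapping.single i k) 1) 1 = (indet i ^ k :: 'k ratfun)" for i k
  proof (induction k)
    case 0
    then show ?case by (simp add: One_fract_def)
  next
    case (Suc k)
    have "Poly_Mapping.single (Poly_Mapping.single i (Suc k)) (1 :: 'k) =
        Poly_Mapping.single (Poly_Mapping.single i 1) 1 * Poly_Mapping.single (Poly_Mapping.single i k) 1"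
      by (simp add: mult_single flip: single_add)
    then show ?case
      by (simp only: Fract_mult Suc indet_def power_Suc)
  qed
  have monomial: "Fract (Poly_Mapping.single a 1) 1 \<in> A"
    if "Poly_Mapping.keys a \<subseteq> I" for a
  proof -
    have "Fract (Poly_Mapping.single (\<Sum>i\<in>B. Poly_Mapping.single i (Poly_Mapping.lookup a i)) 1) 1
       = (\<Prod>i\<in>B. indet i ^ Poly_Mapping.lookup a i :: 'k ratfun)" for B
    proof (induction B rule: infinite_finite_induct)
      case (insert i B)
      have "Poly_Mapping.single (\<Sum>i\<in>insert i B. Poly_Mapping.single i (Poly_Mapping.lookup a i)) 1 =
          Poly_Mapping.single (Poly_Mapping.single i (Poly_Mapping.lookup a i)) 1 *
          Poly_Mapping.single (\<Sum>i\<in>B. Poly_Mapping.single i (Poly_Mapping.lookup a i)) (1::'k)"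
        using insert by (simp add: mult_single)
      then show ?case
        by (simp only: Fract_mult power insert prod.insert[OF insert(1,2)])
    qed (simp_all add: One_fract_def)
    from this[of "Poly_Mapping.keys a"] show ?thesis
      using that gen(2) by (auto simp: poly_mapping_sum_single intro!: A.prod_mem A.power_mem)
  qed
  show "?U \<subseteq> adjoin (range scalar) (indet ` I)"
    unfolding A_def[symmetric]
  proof
    fix x assume "x \<in> ?U"
    then obtain p :: "'k mpoly" where x: "x = Fract p 1"
      and p: "\<forall>a\<in>Poly_Mapping.keys p. Poly_Mapping.keys a \<subseteq> I"
      by blast
    have "Fract (\<Sum>a\<in>B. Poly_Mapping.single a (Poly_Mapping.lookup p a)) 1
        \<in> A" if "B \<subseteq> Poly_Mapping.keys p" for B
      using finite_subset[OF that finite_keys] that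
    proof (induction B rule: finite_induct)
      case empty
      then show ?case using A.zero_mem by (simp add: Zero_fract_def)
    next
      case (insert a B)
      have "Fract (Poly_Mapping.single a (Poly_Mapping.lookup p a)) 1 =
          scalar (Poly_Mapping.lookup p a) * Fract (Poly_Mapping.single a 1) 1"
        by (simp add: scalar_def mult_single)
      moreover have "\<dots> \<in> A"
        using insert p by (intro A.mult_mem gen monomial) auto
      ultimately show ?case
        using insert by (simp add: Fract_add A.add_mem del: add_fract)
    qed
    from this[of "Poly_Mapping.keys p"] show "x \<in> A"
      by (simp add: poly_mapping_sum_single x)
  qed
qed


section \<open>The prime ideal\<close>

lemma partial_degree_eq_0_iff_keys:
  assumes "finite J"
  shows "partial_degree J p = 0 \<longleftrightarrow> (\<forall>a\<in>Poly_Mapping.keys p. Poly_Mapping.keys a \<inter> J = {})"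
  using assms by (auto simp: partial_degree_eq_0_iff exponent_sum_def in_keys_iff disjoint_iff)

text \<open>
  Elements of \<open>L\<close> are fractions whose numerator and denominator have degree \<open>0\<close> in the variables
  from \<open>J\<close>. Conversely, if \<open>f = t / w \<in> L[X\<^sub>i, i \<in> J]\<close> is not in \<open>L\<close>, then some monomial of \<open>t\<close> involves
  a variable from \<open>J\<close>; so \<open>t\<close> has positive degree and \<open>1 / f = w / t\<close> has negative degree.
\<close>

lemma small_reciprocals_polynomials:
  fixes I J :: "nat set"
  assumes "finite J" "I \<inter> J = {}"
  defines "L \<equiv> adjoin_field (range (scalar :: 'k::field \<Rightarrow> _)) (indet ` I)"
  shows "small_reciprocals (adjoin L (indet ` J)) L (negative_degree J)"
proof -
  define W where "W = adjoin (range (scalar :: 'k \<Rightarrow> _)) (indet ` I)"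
  define T where "T = adjoin (range (scalar :: 'k \<Rightarrow> _)) (indet ` (I \<union> J))"
  have L: "L = fractions W W"
    unfolding L_def W_def by (rule adjoin_field_eq_fractions)
  have T': "adjoin L (indet ` J) = fractions T W"
    unfolding L_def W_def T_def image_Un by (rule adjoin_adjoin_field_eq_fractions)
  have W_deg: "\<exists>p. w = Fract p 1 \<and> partial_degree J p = 0" if "w \<in> W" for w
    using that assms(1,2) unfolding W_def adjoin_indet_eq by (auto simp: partial_degree_eq_0_iff_keys)
  have scale: "c * x \<in> negative_degree J" if "c \<in> L" "x \<in> negative_degree J" for c x
  proof -
    obtain u v where uv: "c = u / v" "u \<in> W" "v \<in> W" "v \<noteq> 0"
      using \<open>c \<in> L\<close> unfolding L by (elim fractionsE)
    obtain p q where pq: "u = Fract p 1" "v = Fract q 1"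
        "partial_degree J p = 0" "partial_degree J q = 0"
      using uv W_deg by blast
    have "q \<noteq> 0"
      using uv(4) pq by (auto simp: fract_collapse)
    then show ?thesis
      using mult_mem_negative_degree[of q J p x] pq uv that by simp
  qed
  show ?thesis
  proof (intro small_reciprocals.intro small_reciprocals_axioms.intro)
    show "0 \<in> negative_degree J" "1 \<notin> negative_degree J"
      by (rule zero_mem_negative_degree one_notin_negative_degree)+
    show "L \<subseteq> adjoin L (indet ` J)"
      using subset_adjoin by blast
    show "inverse x \<in> L" if "x \<in> L" for x
      using that inverse_mem_adjoin_field unfolding L_def by blast
    show "x + y \<in> negative_degree J" if "x \<in> negative_degree J" "y \<in> negative_degree J" for x y
      using that by (rule add_mem_negative_degree)
    show "x * y \<in> negative_degree J" if "x \<in> negative_degree J" "y \<in> negative_degree J" for x y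
      using that(1)
    proof (cases rule: negative_degree_cases)
      case (2 p q)
      then show ?thesis
        using mult_mem_negative_degree[of q J p y] that(2) by simp
    qed (simp add: zero_mem_negative_degree)
    show "c * x \<in> negative_degree J" if "c \<in> L" "x \<in> negative_degree J" for c x
      using that by (rule scale)
    show "inverse f \<in> negative_degree J" if f: "f \<in> adjoin L (indet ` J)" "f \<notin> L" for f
    proof -
      obtain t w where tw: "f = t / w" "t \<in> T" "w \<in> W" "w \<noteq> 0"
        using f unfolding T' by (elim fractionsE)
      obtain p where p: "t = Fract p 1" "\<forall>a\<in>Poly_Mapping.keys p. Poly_Mapping.keys a \<subseteq> I \<union> J"
        using tw(2) unfolding T_def adjoin_indet_eq by blast
      obtain q where q: "w = Fract q 1" "partial_degree J q = 0"
        using tw W_deg by blast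
      have "t \<notin> W"
        using f tw fractionsI unfolding L by blast
      then have "partial_degree J p \<noteq> 0"
        using p assms(1) unfolding W_def adjoin_indet_eq
        by (fastforce simp: partial_degree_eq_0_iff_keys)
      moreover from this have "p \<noteq> 0"
        by (auto simp: partial_degree_def)
      moreover have "inverse f = Fract q p"
        using tw p q by simp
      moreover have "q \<noteq> 0"
        using tw(4) q(1) by (auto simp: fract_collapse)
      ultimately show ?thesis
        using negative_degreeI[of p q J] q(2) by simp
    qed
  qed (simp_all add: L_def subring_set_adjoin subring_set_adjoin_field)
qed

theorem proposition4p2:
  fixes n j :: nat and K L R :: "'k::field ratfun set"
  assumes "n \<ge> 1" and "j \<le> n"
    and "K = range scalar"
    and "R = reciprocal_complement (adjoin K (indet ` {1..n}))"
    and "L = adjoin_field K (indet ` {j+1..n})"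
  shows "\<exists>!P. primeideal P (ring_on R) \<and>
    localization_at R P = reciprocal_complement (adjoin L (indet ` {1..j}))"
proof -
  define W where "W = adjoin K (indet ` {j+1..n})"
  define T where "T = adjoin K (indet ` {1..n})"
  define R' where "R' = reciprocal_complement (adjoin L (indet ` {1..j}))"
  define M :: "'k ratfun set" where "M = negative_degree {1..j}"
  \<comment> \<open>The maximal ideal of \<open>R'\<close> is \<open>R' \<inter> M\<close>; this is its contraction to \<open>R\<close>.\<close>
  define P where "P = R \<inter> M"
  interpret small_reciprocals "adjoin L (indet ` {1..j})" L M
    unfolding assms M_def by (rule small_reciprocals_polynomials) auto
  have R: "R = reciprocal_complement T"
    by (simp add: T_def assms)
  interpret RR: subring_set R
    unfolding R by (rule subring_set_reciprocal_complement)
  interpret W: subring_set W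
    unfolding W_def by (rule subring_set_adjoin)
  have vars: "{1..n} = {j+1..n} \<union> {1..j}"
    using \<open>j \<le> n\<close> by auto
  have WT: "W \<subseteq> T"
    unfolding W_def T_def vars image_Un
    using subset_adjoin[of K "indet ` {j+1..n} \<union> indet ` {1..j}"]
    by (intro adjoin_least subring_set_adjoin) auto
  have R'_eq: "R' = {a * w |a w. a \<in> R \<and> w \<in> W \<and> w \<noteq> 0}"
    unfolding R'_def \<open>L = _\<close> adjoin_adjoin_field_eq_fractions R
    unfolding W_def[symmetric] image_Un[symmetric] vars[symmetric] T_def[symmetric]
    by (rule reciprocal_complement_fractions[OF _ W.subring_set_axioms WT])
      (simp add: T_def subring_set_adjoin)
  have R_sub: "R \<subseteq> R'"
    unfolding R R'_def \<open>L = _\<close> adjoin_adjoin_field_eq_fractions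
    unfolding W_def[symmetric] image_Un[symmetric] vars[symmetric] assms(3)[symmetric] T_def[symmetric]
    by (intro reciprocal_complement_mono subset_fractions W.one_mem)
  have "primeideal P (ring_on R)"
  proof (rule RR.primeideal_ring_onI)
    show "P \<subseteq> R" "0 \<in> P" "1 \<notin> P"
      by (auto simp: P_def RR.zero_mem M_zero M_one)
    show "x + y \<in> P" if "x \<in> P" "y \<in> P" for x y
      using that by (auto simp: P_def RR.add_mem M_add)
    show "x * y \<in> P" if "x \<in> R" "y \<in> P" for x y
      using that M_absorb[of x y] R_sub by (auto simp: P_def R'_def RR.mult_mem)
    show "x \<in> P \<or> y \<in> P" if "x \<in> R" "y \<in> R" "x * y \<in> P" for x y
    proof (rule ccontr)
      assume "\<not> (x \<in> P \<or> y \<in> P)"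
      then have nM: "x \<notin> M" "y \<notin> M"
        using that by (auto simp: P_def)
      then have "inverse x \<in> R'" "inverse y \<in> R'"
        using that R_sub inverse_mem_of_not_small unfolding R'_def by blast+
      \<comment> \<open>Both \<open>x\<close> and \<open>y\<close> are units of \<open>R'\<close>, so cancelling them from \<open>x y \<in> M\<close> would give \<open>1 \<in> M\<close>.\<close>
      then have "inverse x * (inverse y * (x * y)) \<in> M"
        using that(3) M_absorb by (auto simp: P_def R'_def)
      moreover have "x \<noteq> 0" "y \<noteq> 0"
        using nM M_zero by auto
      ultimately show False
        using M_one by (simp add: field_simps)
    qed
  qed
  moreover have "localization_at R P = R'"
  proof
    show "localization_at R P \<subseteq> R'"
    proof
      fix x assume "x \<in> localization_at R P"
      then obtain a s where "x = a / s" "a \<in> R" "s \<in> R" "s \<notin> M"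
        unfolding localization_at_def P_def by blast
      then show "x \<in> R'"
        using R_sub inverse_mem_of_not_small[of s] R.mult_mem[of a "inverse s"]
        unfolding R'_def divide_inverse by blast
    qed
    show "R' \<subseteq> localization_at R P"
    proof
      fix x assume "x \<in> R'"
      then obtain a w where x: "x = a * w" "a \<in> R" "w \<in> W" "w \<noteq> 0"
        unfolding R'_eq by blast
      \<comment> \<open>The denominator \<open>1 / w\<close> is a nonzero constant of \<open>L\<close>, so it is not small.\<close>
      have "inverse w \<in> R"
        using x WT unfolding R by (auto intro: inverse_mem_reciprocal_complement)
      moreover have "inverse w \<in> L"
        using x(3) adjoin_subset_adjoin_field inverse_mem_adjoin_field
        unfolding W_def \<open>L = _\<close> by blast
      then have "inverse w \<notin> M"
        using L_inter_M x(4) by fastforce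
      moreover have "x = a / inverse w"
        using x by (simp add: divide_inverse)
      ultimately show "x \<in> localization_at R P"
        using x(2) unfolding localization_at_def P_def by blast
    qed
  qed
  moreover have "Q = P" if "primeideal Q (ring_on R)" "localization_at R Q = R'" for Q
    using prime_eq_nonunits_of_localization[OF that(1) RR.one_mem]
      prime_eq_nonunits_of_localization[OF \<open>primeideal P (ring_on R)\<close> RR.one_mem]
      that(2) \<open>localization_at R P = R'\<close> by simp
  ultimately show ?thesis
    unfolding R'_def by blast
qed

end
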